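(* For any smooth point $\bar R\in\mathcal{B}_{n,r}$ and any $C\in\mathbb{R}^{n\times r}$, the orthogonal projection of $C$ onto the tangent space $T_{\bar R}\mathcal{B}_{n,r}$ is $$\mathrm{Proj}_{T_{\bar R}\mathcal{B}_{n,r}}(C)=J\left(C-\mathrm{diag}(\lambda^{\bar R}_C)\,\bar R\right),$$ where $$\lambda^{\bar R}_C:=\left(I+\bar R\,(I-\bar R^\top\bar R/n)^{-1}\bar R^\top/n\right)\mathrm{diag}(JC\bar R^\top).$$
   Context: $\mathcal{B}_{n,r}:=\{R\in\mathbb{R}^{n\times r}:\ \mathrm{diag}(RR^\top)=e,\ R^\top e=0\}$, $e\in\mathbb{R}^n$ the all-ones vector, $J:=I-ee^\top/n$. For a square matrix $X$, $\mathrm{diag}(X)$ is its diagonal vector; for a vector $x$, $\mathrm{diag}(x)$ is the diagonal matrix with diagonal $x$. $R\in\mathcal{B}_{n,r}$ is a smooth point if LICQ holds at $R$, i.e. $H\mapsto(H^\top e,\mathrm{diag}(HR^\top))$ from $\mathbb{R}^{n\times r}$ to $\mathbb{R}^r\times\mathbb{R}^n$ is surjective (equivalently $\mathrm{rank}(R)\ge2$). The tangent space at a smooth point is $T_R\mathcal{B}_{n,r}:=\{H\in\mathbb{R}^{n\times r}:\ H^\top e=0,\ \mathrm{diag}(HR^\top)=0\}$. Orthogonality is with respect to the Frobenius inner product. *)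

theory Defs
  imports "HOL-Analysis.Analysis"
begin

text \<open>
  A matrix with n rows and r columns is an element of \<^typ>\<open>real^'r^'n\<close>, with \<open>n = CARD('n)\<close> and
  \<open>r = CARD('r)\<close>; the constant \<open>1 :: real^'n\<close> is the all-ones vector. The library inner product
  on \<^typ>\<open>real^'r^'n\<close> is the sum of the products of the entries, i.e. the Frobenius inner product.
\<close>

definition diag_of :: "'a^'n^'n \<Rightarrow> 'a^'n" where
  "diag_of X = (\<chi> i. X $ i $ i)"

definition diag_mat :: "'a::zero^'n \<Rightarrow> 'a^'n^'n" where
  "diag_mat x = (\<chi> i j. if i = j then x $ i else 0)"

definition centering :: "real^'n^'n" where
  "centering = mat 1 - (1 / real CARD('n)) *\<^sub>R
     (columnvector (1 :: real^'n) ** transpose (columnvector 1 :: real^1^'n))"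

definition B_set :: "(real^'r^'n) set" where
  "B_set = {R. diag_of (R ** transpose R) = 1 \<and> transpose R *v 1 = 0}"

definition licq :: "real^'r^'n \<Rightarrow> bool" where
  "licq R \<longleftrightarrow>
     surj (\<lambda>H :: real^'r^'n. (transpose H *v 1, diag_of (H ** transpose R)))"

definition smooth_point :: "real^'r^'n \<Rightarrow> bool" where
  "smooth_point R \<longleftrightarrow> R \<in> B_set \<and> licq R"

definition tangent_space :: "real^'r^'n \<Rightarrow> (real^'r^'n) set" where
  "tangent_space R = {H. transpose H *v 1 = 0 \<and> diag_of (H ** transpose R) = 0}"

text \<open>Only meaningful for a subspace \<open>T\<close>, see \<open>orthogonal_projection_ex1\<close> below.\<close>

definition orthogonal_projection :: "'a::euclidean_space set \<Rightarrow> 'a \<Rightarrow> 'a" where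
  "orthogonal_projection T x = (THE p. p \<in> T \<and> x - p \<in> T\<^sup>\<bottom>)"

definition gram_complement :: "real^'r^'n \<Rightarrow> real^'r^'r" where
  "gram_complement R = mat 1 - (1 / real CARD('n)) *\<^sub>R (transpose R ** R)"

text \<open>
  \<^const>\<open>matrix_inv\<close> is the inverse only for an invertible matrix, so the multiplier below is
  meaningful only if \<^term>\<open>gram_complement R\<close> is invertible.
\<close>

definition multiplier :: "real^'r^'n \<Rightarrow> real^'r^'n \<Rightarrow> real^'n" where
  "multiplier R C =
     (mat 1 + (1 / real CARD('n)) *\<^sub>R (R ** matrix_inv (gram_complement R) ** transpose R))
       *v diag_of (centering ** C ** transpose R)"

lemma orthogonal_projection_ex1:
  fixes T :: "'a::euclidean_space set"
  assumes "subspace T"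
  shows "\<exists>!p. p \<in> T \<and> x - p \<in> T\<^sup>\<bottom>"
proof -
  obtain y z where yz: "y \<in> span T" "\<And>w. w \<in> span T \<Longrightarrow> orthogonal z w" "x = y + z"
    using orthogonal_subspace_decomp_exists by blast
  have T: "span T = T" using assms by (simp add: span_eq_iff)
  have y: "y \<in> T" "z \<in> T\<^sup>\<bottom>"
    using yz(1,2) by (auto simp: T orthogonal_comp_def orthogonal_commute)
  show ?thesis
  proof (rule ex1I[of _ y])
    show "y \<in> T \<and> x - y \<in> T\<^sup>\<bottom>"
      using y yz(3) by simp
  next
    fix p assume p: "p \<in> T \<and> x - p \<in> T\<^sup>\<bottom>"
    have "p - y \<in> T"
      using p y assms by (simp add: subspace_diff)
    moreover have "z - (x - p) \<in> T\<^sup>\<bottom>"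
      using p y by (simp add: subspace_diff subspace_orthogonal_comp)
    then have "p - y \<in> T\<^sup>\<bottom>"
      using yz(3) by (simp add: algebra_simps)
    ultimately have "orthogonal (p - y) (p - y)"
      by (auto simp: orthogonal_comp_def)
    then show "p = y" by (simp add: orthogonal_self)
  qed
qed

lemma subspace_tangent_space: "subspace (tangent_space R)"
  by (auto simp: subspace_def tangent_space_def diag_of_def vec_eq_iff transpose_def
      matrix_matrix_mult_def matrix_vector_mult_def sum.distrib distrib_right
      mult.assoc simp flip: sum_distrib_left)

end

theory Submission
  imports Defs
begin

text \<open>
  The constraint map \<open>H \<mapsto> (H\<^sup>T e, diag (H R\<^sup>T))\<close> has the adjoint \<open>(y, l) \<mapsto> e y\<^sup>T + diag(l) R\<close>
  (lemmas \<open>inner_constant_rows\<close> and \<open>inner_diag_mat_mult\<close>). The tangent space is the kernel of the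
  constraint map, so it is orthogonal to every matrix of the form \<open>e y\<^sup>T + diag(l) R\<close>. Centering
  changes a matrix only by some \<open>e y\<^sup>T\<close>, hence \<open>C - J (C - diag(l) R)\<close> has this form for every
  choice of \<open>l\<close>. It remains to choose \<open>l\<close> so that \<open>J (C - diag(l) R)\<close> is tangent. Its columns sum to
  zero by centering, and because the rows of \<open>R\<close> are unit vectors the other constraint reads
  \<open>(I - R R\<^sup>T / n) l = diag (J C R\<^sup>T)\<close>. The Woodbury identity (lemma \<open>woodbury_gram_complement\<close>)
  solves this \<open>n \<times> n\<close> system through the inverse of the \<open>r \<times> r\<close> matrix \<open>I - R\<^sup>T R / n\<close>, and the
  solution is the multiplier.

  The small matrix is invertible because of LICQ, which makes the adjoint of the constraint map
  injective: for a kernel vector \<open>v\<close> the matrix \<open>diag(R v) R - e v\<^sup>T\<close> has squared Frobenius norm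
  \<open>n |v|\<^sup>2 - |R v|\<^sup>2 = 0\<close>, so \<open>(-v, R v)\<close> is in the kernel of the adjoint and \<open>v = 0\<close>
  (lemma \<open>invertible_gram_complement\<close>).
\<close>

lemma matrix_diff_ldistrib: "A ** (B - C) = A ** B - A ** C"
  for A :: "'a::ring_1^'n^'m" and B C :: "'a^'p^'n"
  by (simp add: vec_eq_iff matrix_matrix_mult_def right_diff_distrib sum_subtractf)

lemma matrix_diff_rdistrib: "(A - B) ** C = A ** C - B ** C"
  for A B :: "'a::ring_1^'n^'m" and C :: "'a^'p^'n"
  by (simp add: vec_eq_iff matrix_matrix_mult_def left_diff_distrib sum_subtractf)

lemma matrix_inv_right:
  assumes "invertible A"
  shows "A ** matrix_inv A = mat 1"
  using assms unfolding invertible_def matrix_inv_def by (rule someI2_ex) blast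

lemma diag_mat_mult_row: "(diag_mat l ** R) $ i = l $ i *\<^sub>R R $ i"
  for R :: "real^'r^'n"
  by (simp add: vec_eq_iff matrix_matrix_mult_def diag_mat_def if_distrib [of "\<lambda>x. x * _"] cong: if_cong)

lemma diag_of_mult_transpose: "diag_of (A ** transpose B) $ i = A $ i \<bullet> B $ i"
  for A B :: "real^'r^'n"
  by (simp add: diag_of_def matrix_matrix_mult_def transpose_def inner_vec_def)

lemma inner_constant_rows: "H \<bullet> (\<chi> i. y) = (transpose H *v 1) \<bullet> y"
  for H :: "real^'r^'n"
proof -
  have "transpose H *v 1 = (\<Sum>i\<in>UNIV. H $ i)"
    by (simp add: vec_eq_iff matrix_vector_mult_def transpose_def)
  then show ?thesis
    by (simp add: inner_vec_def [of H] inner_sum_left)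
qed

lemma inner_diag_mat_mult: "H \<bullet> (diag_mat l ** R) = diag_of (H ** transpose R) \<bullet> l"
  for H R :: "real^'r^'n"
  by (simp add: inner_vec_def [of H] inner_vec_def [of _ l] diag_mat_mult_row
      diag_of_mult_transpose mult.commute)

lemma centering_mult:
  "centering ** X = X - (\<chi> i. (1 / real CARD('n)) *\<^sub>R (transpose X *v 1))"
  for X :: "real^'r^'n"
proof -
  have "(columnvector (1 :: real^'n) ** transpose (columnvector 1 :: real^1^'n)) ** X
      = (\<chi> i. transpose X *v 1)"
    by (simp add: vec_eq_iff matrix_matrix_mult_def matrix_vector_mult_def columnvector_def
        transpose_def)
  then show ?thesis
    by (simp add: centering_def matrix_diff_rdistrib scalar_matrix_assoc [symmetric])
       (simp add: vec_eq_iff)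
qed

lemma column_sums_centering_mult: "transpose (centering ** X) *v 1 = 0"
  for X :: "real^'r^'n"
  by (simp add: centering_mult vec_eq_iff matrix_vector_mult_def transpose_def sum_subtractf
      del: transpose_matrix_vector)

lemma B_set_row_norm:
  assumes "R \<in> B_set"
  shows "R $ i \<bullet> R $ i = 1"
  using assms by (simp add: B_set_def vec_eq_iff flip: diag_of_mult_transpose)

text \<open>
  If \<open>v\<close> is in the kernel, then \<open>diag(R v) R\<close> and \<open>e v\<^sup>T\<close> coincide: row by row their squared distance
  is \<open>|v|\<^sup>2 - (R v)\<^sub>i\<^sup>2\<close>, because the rows of \<open>R\<close> are unit vectors, and the sum
  \<open>n |v|\<^sup>2 - |R v|\<^sup>2\<close> is \<open>n\<close> times the quadratic form of the Gram complement at \<open>v\<close>. LICQ supplies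
  \<open>H\<close> with \<open>H\<^sup>T e = v\<close> and \<open>diag (H R\<^sup>T) = 0\<close>; its inner product with this common matrix is \<open>v \<bullet> v\<close>
  from one form and \<open>0\<close> from the other.
\<close>

lemma invertible_gram_complement:
  fixes R :: "real^'r^'n"
  assumes "R \<in> B_set" and "licq R"
  shows "invertible (gram_complement R)"
proof -
  have "v = 0" if "gram_complement R *v v = 0" for v
  proof -
    let ?D = "diag_mat (R *v v) ** R" and ?E = "(\<chi> i. v) :: real^'r^'n"
    have Rv: "(R *v v) $ i = R $ i \<bullet> v" for i
      by (simp add: matrix_vector_mult_def inner_vec_def)
    have "v - (1 / real CARD('n)) *\<^sub>R (transpose R *v (R *v v)) = 0"
      using that by (simp add: gram_complement_def matrix_vector_mult_diff_rdistrib
          scaleR_matrix_vector_assoc [symmetric] matrix_vector_mul_assoc [symmetric])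
    then have "transpose R *v (R *v v) = real CARD('n) *\<^sub>R v"
      by (simp add: field_simps vec_eq_iff)
    then have "(R *v v) \<bullet> (R *v v) = real CARD('n) * (v \<bullet> v)"
      by (metis dot_lmul_matrix inner_scaleR_left transpose_matrix_vector)
    then have sq: "(\<Sum>i\<in>UNIV. (R $ i \<bullet> v)\<^sup>2) = real CARD('n) * (v \<bullet> v)"
      by (simp add: inner_vec_def [of "R *v v"] Rv power2_eq_square)
    have row: "(?D - ?E) $ i \<bullet> (?D - ?E) $ i = v \<bullet> v - (R $ i \<bullet> v)\<^sup>2" for i
      using B_set_row_norm [OF assms(1), of i]
      by (simp add: diag_mat_mult_row Rv inner_diff_left inner_diff_right power2_eq_square
          inner_commute)
    have "(?D - ?E) \<bullet> (?D - ?E) = 0"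
      unfolding inner_vec_def [of "?D - ?E"] row by (simp add: sum_subtractf sq)
    then have DE: "?D = ?E"
      by simp
    from assms(2) obtain H :: "real^'r^'n"
      where "transpose H *v 1 = v" "diag_of (H ** transpose R) = 0"
      unfolding licq_def surj_def by (metis prod.inject)
    then have "v \<bullet> v = 0"
      by (metis DE inner_constant_rows inner_diag_mat_mult inner_zero_left)
    then show ?thesis by simp
  qed
  then show ?thesis
    by (metis invertible_left_inverse matrix_left_invertible_ker)
qed

text \<open>
  The product telescopes because \<open>(I - R R\<^sup>T / n) R = R (I - R\<^sup>T R / n)\<close>, so the inverse cancels.
\<close>

lemma woodbury_gram_complement:
  fixes R :: "real^'r^'n"
  assumes "invertible (gram_complement R)"
  shows "(mat 1 - (1 / real CARD('n)) *\<^sub>R (R ** transpose R))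
    ** (mat 1 + (1 / real CARD('n)) *\<^sub>R (R ** matrix_inv (gram_complement R) ** transpose R))
    = mat 1"
proof -
  let ?G = "gram_complement R" and ?c = "1 / real CARD('n)"
  let ?A = "mat 1 - ?c *\<^sub>R (R ** transpose R)"
  have "?A ** R = R ** ?G"
    by (simp add: gram_complement_def matrix_diff_rdistrib matrix_diff_ldistrib matrix_mul_assoc
        scalar_matrix_assoc [symmetric] matrix_scalar_ac)
  then have "?A ** (R ** matrix_inv ?G ** transpose R) = R ** transpose R"
    using assms by (metis matrix_inv_right matrix_mul_assoc matrix_mul_rid)
  then show ?thesis
    by (simp add: matrix_add_ldistrib matrix_scalar_ac scalar_matrix_assoc [symmetric])
qed

text \<open>
  Since \<open>J diag(l) R = diag(l) R - e (R\<^sup>T l)\<^sup>T / n\<close>, the diagonal has the two parts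
  \<open>diag (diag(l) R R\<^sup>T)\<close> and \<open>R R\<^sup>T l / n\<close>; the unit rows of \<open>R\<close> turn the first one into \<open>l\<close>.
\<close>

lemma diag_of_centered_diag_mat:
  fixes R :: "real^'r^'n"
  assumes "R \<in> B_set"
  shows "diag_of (centering ** (diag_mat l ** R) ** transpose R)
    = (mat 1 - (1 / real CARD('n)) *\<^sub>R (R ** transpose R)) *v l"
proof -
  have col: "transpose (diag_mat l ** R) *v 1 = transpose R *v l"
    by (simp add: vec_eq_iff matrix_vector_mult_def transpose_def diag_mat_mult_row mult.commute)
  have "(transpose R *v l) \<bullet> R $ i = (R *v (transpose R *v l)) $ i" for i
    by (simp add: matrix_vector_mult_def [of R] inner_vec_def mult.commute)
  then show ?thesis
    by (simp add: vec_eq_iff diag_of_mult_transpose centering_mult col diag_mat_mult_row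
        inner_diff_left B_set_row_norm [OF assms] matrix_vector_mult_diff_rdistrib
        scaleR_matrix_vector_assoc [symmetric] matrix_vector_mul_assoc [symmetric]
        del: transpose_matrix_vector)
qed

lemma orthogonal_projection_eqI:
  assumes "subspace T" "p \<in> T" "x - p \<in> T\<^sup>\<bottom>"
  shows "orthogonal_projection T x = p"
  unfolding orthogonal_projection_def
  using orthogonal_projection_ex1 [OF assms(1), of x] assms(2,3) by (intro the1_equality) auto

theorem theorem3p4:
  fixes R C :: "real^'r^'n"
  assumes "smooth_point R"
  shows "invertible (gram_complement R) \<and>
    orthogonal_projection (tangent_space R) C
      = centering ** (C - diag_mat (multiplier R C) ** R)"
proof
  have B: "R \<in> B_set" and "licq R"
    using assms by (auto simp: smooth_point_def)
  then show inv: "invertible (gram_complement R)"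
    by (rule invertible_gram_complement)
  let ?l = "multiplier R C"
  let ?X = "C - diag_mat ?l ** R"
  let ?P = "centering ** ?X"
  have "(mat 1 - (1 / real CARD('n)) *\<^sub>R (R ** transpose R)) *v ?l
      = diag_of (centering ** C ** transpose R)"
    unfolding multiplier_def
    by (simp add: matrix_vector_mul_assoc woodbury_gram_complement [OF inv])
  then have "diag_of (centering ** C ** transpose R)
      = diag_of (centering ** (diag_mat ?l ** R) ** transpose R)"
    by (simp add: diag_of_centered_diag_mat [OF B])
  then have "diag_of (?P ** transpose R) = 0"
    by (simp add: vec_eq_iff matrix_diff_ldistrib diag_of_mult_transpose inner_diff_left)
  then have P: "?P \<in> tangent_space R"
    by (simp add: tangent_space_def column_sums_centering_mult del: transpose_matrix_vector)
  have "C - ?P = diag_mat ?l ** R + (\<chi> i. (1 / real CARD('n)) *\<^sub>R (transpose ?X *v 1))"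
    by (subst centering_mult) simp
  then have "H \<bullet> (C - ?P) = 0" if "H \<in> tangent_space R" for H
    using that
    by (simp add: tangent_space_def inner_add_right inner_diag_mat_mult inner_constant_rows
        del: transpose_matrix_vector)
  then have "C - ?P \<in> (tangent_space R)\<^sup>\<bottom>"
    by (simp add: orthogonal_comp_def orthogonal_def)
  with P show "orthogonal_projection (tangent_space R) C = ?P"
    by (intro orthogonal_projection_eqI subspace_tangent_space)
qed

end
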